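(* Let $u\in\mathscr{U}_N$, $v\in\mathscr{U}$ and $r\ge 0$, and let $\mathbb{B}_N(u,r)=\{w\in\mathscr{U}_N:\mathsf{d}_{\mathscr{G}}(w,u)\le r\}$ and $\mathbb{B}(v,r)=\{w\in\mathscr{U}:\mathsf{d}_{\mathscr{G}}(w,v)\le r\}$. Assume: (a) $\mathbb{B}(v,r)$ consists of utility functions all of which are Lipschitz continuous with modulus bounded by $L$; (b) $\mathscr{G}=\mathscr{G}_L$ or $\mathscr{G}=\mathscr{G}_I$. Then $$\mathbb{H}(\mathbb{B}_N(u,r),\mathbb{B}(v,r);\mathsf{d}_{\mathscr{G}})\le \mathsf{d}_{\mathscr{G}}(u,v)+4\max(2,L)\,\beta_N,$$ where $\beta_N=\max_{i=2,\dots,N}(y_i-y_{i-1})$. In the case when $u=v_N$ is the projection of $v$ on $\mathscr{U}_N$, $$\mathbb{H}(\mathbb{B}_N(v_N,r),\mathbb{B}(v,r);\mathsf{d}_{\mathscr{G}})\le 6\max(2,L)\,\beta_N.$$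
   Context: $\mathscr{U}$ is the set of all continuous non-decreasing functions $u$ on $[a,b]$ with $u(a)=0$, $u(b)=1$. For a fixed ordered set of breakpoints $a=y_1<\dots<y_N=b$, $\mathscr{U}_N\subset\mathscr{U}$ is the class of continuous, non-decreasing, piecewise linear functions with breakpoints in $\{y_1,\dots,y_N\}$. The projection $v_N$ of $v\in\mathscr{U}$ on $\mathscr{U}_N$ is $$v_N(y)=v(y_{i-1})+\frac{v(y_i)-v(y_{i-1})}{y_i-y_{i-1}}(y-y_{i-1}),\quad y\in[y_{i-1},y_i],\ i=2,\dots,N.$$ For a set $\mathscr{G}$ of measurable functions on $[a,b]$, $\mathsf{d}_{\mathscr{G}}(u,v)=\sup_{g\in\mathscr{G}}|\int_a^b g(z)\,du(z)-\int_a^b g(z)\,dv(z)|$ (Lebesgue–Stieltjes integrals). $\mathscr{G}_L$ is the set of $g:[a,b]\to\mathbb{R}$ Lipschitz continuous with modulus bounded by $1$; $\mathscr{G}_I$ is the set of indicator functions $\mathbb{1}_{(a,z]}$ of intervals $(a,z]$. For sets $U,V\subset\mathscr{U}$, $\mathbb{D}(U,V;\mathsf{d}_{\mathscr{G}})=\sup_{u\in U}\inf_{v\in V}\mathsf{d}_{\mathscr{G}}(u,v)$ and $\mathbb{H}(U,V;\mathsf{d}_{\mathscr{G}})=\max\{\mathbb{D}(U,V;\mathsf{d}_{\mathscr{G}}),\mathbb{D}(V,U;\mathsf{d}_{\mathscr{G}})\}$. *)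

theory Defs
  imports "HOL-Analysis.Analysis"
begin

text \<open>
  Functions on \<open>[a,b]\<close> are total functions \<open>real \<Rightarrow> real\<close> of which only the values on
  \<open>{a..b}\<close> matter: no membership condition, integral or distance below depends on values
  outside \<open>{a..b}\<close>.
\<close>

definition utilities :: "real \<Rightarrow> real \<Rightarrow> (real \<Rightarrow> real) set" where
  "utilities a b = {u. continuous_on {a..b} u \<and> mono_on {a..b} u \<and> u a = 0 \<and> u b = 1}"

definition breakpoints :: "real \<Rightarrow> real \<Rightarrow> nat \<Rightarrow> (nat \<Rightarrow> real) \<Rightarrow> bool" where
  "breakpoints a b N y \<longleftrightarrow> 2 \<le> N \<and> y 1 = a \<and> y N = b \<and> strict_mono_on {1..N} y"

definition pl_utilities :: "real \<Rightarrow> real \<Rightarrow> nat \<Rightarrow> (nat \<Rightarrow> real) \<Rightarrow> (real \<Rightarrow> real) set" where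
  "pl_utilities a b N y = {u \<in> utilities a b.
     \<forall>i\<in>{2..N}. \<exists>c d. \<forall>x\<in>{y (i - 1)..y i}. u x = c + d * x}"

definition mesh :: "nat \<Rightarrow> (nat \<Rightarrow> real) \<Rightarrow> real" where
  "mesh N y = Max ((\<lambda>i. y i - y (i - 1)) ` {2..N})"

text \<open>
  The piece containing \<open>x\<close> is selected as the first one whose right end is at least \<open>x\<close>; the
  lemma \<open>pl_projection_eq\<close> shows that the choice is immaterial at the breakpoints.
\<close>

definition pl_projection :: "(nat \<Rightarrow> real) \<Rightarrow> (real \<Rightarrow> real) \<Rightarrow> real \<Rightarrow> real" where
  "pl_projection y v x =
     (let i = (LEAST i. 2 \<le> i \<and> x \<le> y i)
      in v (y (i - 1)) + (v (y i) - v (y (i - 1))) / (y i - y (i - 1)) * (x - y (i - 1)))"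

lemma pl_projection_eq:
  assumes "breakpoints a b N y" "i \<in> {2..N}" "x \<in> {y (i - 1)..y i}"
  shows "pl_projection y v x =
    v (y (i - 1)) + (v (y i) - v (y (i - 1))) / (y i - y (i - 1)) * (x - y (i - 1))"
proof -
  have sm: "y j < y k" if "1 \<le> j" "j < k" "k \<le> N" for j k
    using assms(1) that by (auto simp: breakpoints_def strict_mono_on_def)
  define k where "k = (LEAST i. 2 \<le> i \<and> x \<le> y i)"
  have k: "2 \<le> k" "x \<le> y k"
    using LeastI[of "\<lambda>i. 2 \<le> i \<and> x \<le> y i" i] assms by (auto simp: k_def)
  have le: "k \<le> i"
    using assms by (auto simp: k_def intro: Least_le)
  show ?thesis
  proof (cases "k = i")
    case True
    then show ?thesis by (simp add: pl_projection_def flip: k_def)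
  next
    case False
    have "\<not> k < i - 1"
      using sm[of k "i - 1"] k assms(2,3) by fastforce
    with False le k have ki: "k = i - 1" by simp
    with k assms have x: "x = y (i - 1)" by auto
    have "y (k - 1) < y k" using k ki assms sm[of "k - 1" k] by auto
    moreover have "y k = x" using ki x by simp
    ultimately have "pl_projection y v x = v x"
      by (simp add: pl_projection_def Let_def flip: k_def)
    then show ?thesis using x by simp
  qed
qed

text \<open>
  The integrator is extended by the constants \<open>u a\<close> and \<open>u b\<close> outside \<open>[a,b]\<close>, since
  \<^const>\<open>interval_measure\<close> expects a non-decreasing right-continuous function on the whole line.
  For \<open>u\<close> continuous on \<open>[a,b]\<close> there is no mass at \<open>a\<close>.
\<close>

definition stieltjes_integral ::
    "real \<Rightarrow> real \<Rightarrow> (real \<Rightarrow> real) \<Rightarrow> (real \<Rightarrow> real) \<Rightarrow> real" where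
  "stieltjes_integral a b g u =
     (LINT z:{a..b}|interval_measure (\<lambda>x. u (max a (min b x))). g z)"

text \<open>
  The distances are \<^typ>\<open>ereal\<close>-valued, so that suprema and infima never require a boundedness
  side condition.
\<close>

definition pseudo_dist ::
    "real \<Rightarrow> real \<Rightarrow> (real \<Rightarrow> real) set \<Rightarrow> (real \<Rightarrow> real) \<Rightarrow> (real \<Rightarrow> real) \<Rightarrow> ereal" where
  "pseudo_dist a b G u v =
     (SUP g\<in>G. ereal \<bar>stieltjes_integral a b g u - stieltjes_integral a b g v\<bar>)"

definition lipschitz_class :: "real \<Rightarrow> real \<Rightarrow> (real \<Rightarrow> real) set" where
  "lipschitz_class a b = {g. 1-lipschitz_on {a..b} g}"

definition indicator_class :: "real \<Rightarrow> real \<Rightarrow> (real \<Rightarrow> real) set" where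
  "indicator_class a b = {indicator {a<..z} |z. z \<in> {a..b}}"

definition excess :: "('a \<Rightarrow> 'a \<Rightarrow> ereal) \<Rightarrow> 'a set \<Rightarrow> 'a set \<Rightarrow> ereal" where
  "excess d U V = (SUP u\<in>U. INF v\<in>V. d u v)"

definition hausdorff :: "('a \<Rightarrow> 'a \<Rightarrow> ereal) \<Rightarrow> 'a set \<Rightarrow> 'a set \<Rightarrow> ereal" where
  "hausdorff d U V = max (excess d U V) (excess d V U)"

definition utility_ball ::
    "real \<Rightarrow> real \<Rightarrow> (real \<Rightarrow> real) set \<Rightarrow> (real \<Rightarrow> real) \<Rightarrow> real \<Rightarrow> (real \<Rightarrow> real) set" where
  "utility_ball a b G v r = {w \<in> utilities a b. pseudo_dist a b G w v \<le> ereal r}"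

definition pl_utility_ball ::
    "real \<Rightarrow> real \<Rightarrow> nat \<Rightarrow> (nat \<Rightarrow> real) \<Rightarrow> (real \<Rightarrow> real) set \<Rightarrow> (real \<Rightarrow> real) \<Rightarrow> real
      \<Rightarrow> (real \<Rightarrow> real) set" where
  "pl_utility_ball a b N y G u r = {w \<in> pl_utilities a b N y. pseudo_dist a b G w u \<le> ereal r}"

end

theory Submission
  imports Defs
begin

text \<open>
  Two facts drive the proof. First, for a 1-Lipschitz integrand the Stieltjes integral differs from
  the Riemann sum over a partition by at most the mesh. Two utilities that agree at the breakpoints
  are thus at distance at most twice the mesh, and, along ever finer partitions, the integral is
  affine in the integrator. Second, hence distances scale along segments: if \<open>w\<close> lies within
  \<open>r + e\<close> of the centre \<open>c\<close> of a ball of radius \<open>r\<close>, moving \<open>w\<close> along the segment towards \<open>c\<close> reaches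
  the ball after a distance of at most \<open>e\<close>.
\<close>

section \<open>Breakpoints\<close>

lemma breakpoints_less:
  assumes "breakpoints a b N y" "1 \<le> j" "j < k" "k \<le> N"
  shows "y j < y k"
  using assms by (auto simp: breakpoints_def strict_mono_on_def)

lemma breakpoints_le:
  assumes "breakpoints a b N y" "1 \<le> j" "j \<le> k" "k \<le> N"
  shows "y j \<le> y k"
  using breakpoints_less[OF assms(1,2), of k] assms by (cases "j = k") auto

lemma breakpoints_in:
  assumes "breakpoints a b N y" "1 \<le> k" "k \<le> N"
  shows "y k \<in> {a..b}"
  using breakpoints_le[OF assms(1), of 1 k] breakpoints_le[OF assms(1), of k N] assms
  by (auto simp: breakpoints_def)

lemma breakpoints_ends:
  assumes "breakpoints a b N y"
  shows "2 \<le> N" "y 1 = a" "y N = b" "a < b"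
  using assms breakpoints_less[OF assms, of 1 N] by (auto simp: breakpoints_def)

lemma breakpoints_piece:
  assumes "breakpoints a b N y" "x \<in> {a..b}"
  obtains i where "i \<in> {2..N}" "x \<in> {y (i - 1)..y i}"
proof -
  define i where "i = (LEAST i. 2 \<le> i \<and> x \<le> y i)"
  have ex: "2 \<le> N \<and> x \<le> y N"
    using breakpoints_ends[OF assms(1)] assms(2) by auto
  have i: "2 \<le> i" "x \<le> y i"
    using LeastI[of "\<lambda>i. 2 \<le> i \<and> x \<le> y i", OF ex] by (auto simp: i_def)
  have "i \<le> N"
    unfolding i_def by (rule Least_le) (rule ex)
  moreover have "y (i - 1) \<le> x"
  \<comment> \<open>Minimality of \<open>i\<close> says something about \<open>i - 1\<close> only
    when \<open>2 \<le> i - 1\<close>. For \<open>i = 2\<close> the left end is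
    \<open>y 1 = a\<close>, below \<open>x\<close> anyway.\<close>
  proof (cases "i = 2")
    case True
    then show ?thesis using breakpoints_ends[OF assms(1)] assms(2) by auto
  next
    case False
    then have "\<not> (2 \<le> i - 1 \<and> x \<le> y (i - 1))"
      using i not_less_Least[of "i - 1" "\<lambda>i. 2 \<le> i \<and> x \<le> y i"] by (auto simp: i_def[symmetric])
    then show ?thesis using False i by auto
  qed
  ultimately show ?thesis using that i by auto
qed

lemma mesh_ge:
  assumes "i \<in> {2..N}"
  shows "y i - y (i - 1) \<le> mesh N y"
  unfolding mesh_def using assms by (intro Max_ge) auto

lemma mesh_nonneg:
  assumes "breakpoints a b N y"
  shows "0 \<le> mesh N y"
  using mesh_ge[of 2 N y] breakpoints_le[OF assms, of 1 2] breakpoints_ends[OF assms] by auto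

text \<open>Supplies the ever finer partitions along which the error of a Riemann sum is sent to
  zero.\<close>

lemma breakpoints_fine:
  fixes a b e :: real
  assumes "a < b" "e > 0"
  obtains N y where "breakpoints a b N y" "mesh N y \<le> e"
proof -
  obtain n :: nat where n: "(b - a) / e < real n"
    using reals_Archimedean2 by blast
  have n0: "n > 0"
    using n assms by (cases n) (auto simp: divide_less_0_iff)
  \<comment> \<open>The equidistant partition into \<open>n\<close> pieces. Numbering starts at 1,
    so the shift by one puts \<open>y 1\<close> at \<open>a\<close> and \<open>y (Suc n)\<close> at
    \<open>b\<close>.\<close>
  define y where "y i = a + (b - a) * (real i - 1) / real n" for i :: nat
  have "breakpoints a b (Suc n) y"
    using n0 assms by (auto simp: breakpoints_def y_def strict_mono_on_def
        intro!: divide_strict_right_mono mult_strict_left_mono)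
  moreover have "mesh (Suc n) y \<le> e"
  proof -
    have "y i - y (i - 1) \<le> e" if "i \<in> {2..Suc n}" for i
    proof -
      have "real (i - 1) = real i - 1" using that by auto
      then have "y i - y (i - 1) = (b - a) / real n"
        using n0 by (simp add: y_def field_simps)
      moreover have "(b - a) / real n \<le> e"
        using n n0 assms by (simp add: field_simps)
      ultimately show ?thesis by linarith
    qed
    then show ?thesis
      unfolding mesh_def using n0 by (intro Max.boundedI) auto
  qed
  ultimately show ?thesis by (rule that)
qed

section \<open>The Stieltjes integral\<close>

lemma lipschitz_class_bound:
  assumes "g \<in> lipschitz_class a b" "x \<in> {a..b}" "z \<in> {a..b}"
  shows "\<bar>g x - g z\<bar> \<le> \<bar>x - z\<bar>"
  using lipschitz_onD[of 1 "{a..b}" g x z] assms by (auto simp: lipschitz_class_def dist_real_def)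

lemma utilities_mono:
  assumes "u \<in> utilities a b" "x \<in> {a..b}" "z \<in> {a..b}" "x \<le> z"
  shows "u x \<le> u z"
  using assms mono_onD[of "{a..b}" u x z] by (simp add: utilities_def)

text \<open>One integrator is fixed here, so that later proofs can interpret the locale for several
  utilities on the same interval side by side.\<close>

locale stieltjes =
  fixes a b :: real and u :: "real \<Rightarrow> real"
  assumes ab: "a \<le> b" and u: "u \<in> utilities a b"
begin

abbreviation M :: "real measure" where
  "M \<equiv> interval_measure (\<lambda>x. u (max a (min b x)))"

lemma mono_extension: "x \<le> z \<Longrightarrow> u (max a (min b x)) \<le> u (max a (min b z))"
  using ab by (intro utilities_mono[OF u]) auto

lemma continuous_extension: "continuous_on UNIV (\<lambda>x. u (max a (min b x)))"
proof (rule continuous_on_compose2[of "{a..b}" u])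
  show "continuous_on {a..b} u"
    using u by (simp add: utilities_def)
  show "continuous_on UNIV (\<lambda>x. max a (min b x))"
    by (intro continuous_intros)
  show "range (\<lambda>x. max a (min b x)) \<subseteq> {a..b}"
    using ab by auto
qed

lemma emeasure_Icc:
  assumes "a \<le> c" "c \<le> d" "d \<le> b"
  shows "emeasure M {c..d} = ennreal (u d - u c)"
  using emeasure_interval_measure_Icc[of c d "\<lambda>x. u (max a (min b x))",
      OF assms(2) mono_extension continuous_extension] assms by simp

lemma emeasure_Ioc:
  assumes "a \<le> c" "c \<le> d" "d \<le> b"
  shows "emeasure M {c<..d} = ennreal (u d - u c)"
  using emeasure_interval_measure_Ioc[of c d "\<lambda>x. u (max a (min b x))",
      OF assms(2) mono_extension] continuous_extension assms
  by (auto simp: continuous_on_eq_continuous_at continuous_at_imp_continuous_at_within)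

lemma measure_Ioc:
  assumes "a \<le> c" "c \<le> d" "d \<le> b"
  shows "measure M {c<..d} = u d - u c"
  using emeasure_Ioc[OF assms] mono_extension[of c d] assms
  by (auto simp: measure_def)

text \<open>A continuous function is bounded on the compact interval, and the interval has finite
  mass.\<close>

lemma integrable_on_continuous:
  fixes g :: "real \<Rightarrow> real"
  assumes "continuous_on {a..b} g" "A \<in> sets borel" "A \<subseteq> {a..b}"
  shows "set_integrable M A g"
proof (rule set_integrable_subset)
  have "bounded (g ` {a..b})"
    by (intro compact_imp_bounded compact_continuous_image assms(1)) auto
  then obtain B where B: "\<And>x. x \<in> {a..b} \<Longrightarrow> norm (g x) \<le> B"
    unfolding bounded_iff by blast
  show "set_integrable M {a..b} g"
    unfolding set_integrable_def
  proof (rule integrableI_bounded_set[of "{a..b}" _ _ B])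
    show "(\<lambda>x. indicator {a..b} x *\<^sub>R g x) \<in> borel_measurable M"
      using borel_measurable_continuous_on_indicator[OF _ assms(1)] by simp
    show "emeasure M {a..b} < \<infinity>"
      using emeasure_Icc[of a b] ab by simp
    show "AE x in M. x \<in> {a..b} \<longrightarrow> norm (indicat_real {a..b} x *\<^sub>R g x) \<le> B"
      using B by auto
  qed auto
qed (use assms in auto)

text \<open>Continuity of the integrator leaves no mass at \<open>a\<close>. This starts the
  induction over the pieces of a Riemann sum.\<close>

lemma integral_point:
  "(LINT z:{a..a}|M. g z) = (0::real)"
  unfolding set_lebesgue_integral_def
proof (rule integral_eq_zero_AE)
  have "{a} \<in> null_sets M"
    using emeasure_Icc[of a a] ab by (auto simp: null_sets_def)
  then have "AE x in M. x \<notin> {a}" by (rule AE_not_in)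
  then show "AE x in M. indicat_real {a..a} x *\<^sub>R g x = 0"
    by eventually_elim auto
qed

text \<open>By the Lipschitz bound \<open>g\<close> stays within \<open>h\<close> of its value at
  the right end \<open>d\<close>. Integrating the constants \<open>g d + h\<close> and
  \<open>g d - h\<close> over a set of mass \<open>u d - u c\<close> encloses the integral.\<close>

lemma integral_piece:
  assumes g: "g \<in> lipschitz_class a b" and cd: "a \<le> c" "c \<le> d" "d \<le> b" and h: "d - c \<le> h"
  shows "\<bar>(LINT z:{c<..d}|M. g z) - g d * (u d - u c)\<bar> \<le> h * (u d - u c)"
proof -
  have cont: "continuous_on {a..b} g"
    using g by (auto simp: lipschitz_class_def intro: lipschitz_on_continuous_on)
  have fin: "emeasure M {c<..d} \<noteq> \<infinity>"
    using emeasure_Ioc[OF cd] by simp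
  have const: "(LINT z:{c<..d}|M. k) = (u d - u c) * k" for k :: real
    using set_integral_const[OF _ fin, of k] measure_Ioc[OF cd] by simp
  have int: "set_integrable M {c<..d} f" if "continuous_on {a..b} f" for f :: "real \<Rightarrow> real"
    using that cd by (intro integrable_on_continuous) auto
  have bound: "g x \<le> g d + h" "g d - h \<le> g x" if "x \<in> {c<..d}" for x
    using lipschitz_class_bound[OF g, of x d] that cd h by auto
  have "(LINT z:{c<..d}|M. g z) \<le> (LINT z:{c<..d}|M. g d + h)"
    using cont by (intro set_integral_mono int bound) auto
  moreover have "(LINT z:{c<..d}|M. g d - h) \<le> (LINT z:{c<..d}|M. g z)"
    using cont by (intro set_integral_mono int bound) auto
  ultimately show ?thesis
    by (simp add: const abs_le_iff algebra_simps)
qed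

text \<open>Each piece contributes an error of at most the mesh times its own mass, and the masses
  telescope to \<open>u b - u a = 1\<close>.\<close>

lemma integral_riemann_sum:
  assumes g: "g \<in> lipschitz_class a b" and y: "breakpoints a b N y"
  shows "\<bar>stieltjes_integral a b g u - (\<Sum>i=2..N. g (y i) * (u (y i) - u (y (i - 1))))\<bar> \<le> mesh N y"
proof -
  have cont: "continuous_on {a..b} g"
    using g by (auto simp: lipschitz_class_def intro: lipschitz_on_continuous_on)
  \<comment> \<open>Induction over the prefixes \<open>{a..y n}\<close>, with the error weighted by
    the mass collected so far. The base is the one-point interval, since
    \<open>y 1 = a\<close>.\<close>
  have "n \<le> N \<longrightarrow> \<bar>(LINT z:{a..y n}|M. g z) - (\<Sum>i=2..n. g (y i) * (u (y i) - u (y (i - 1))))\<bar>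
          \<le> mesh N y * (u (y n) - u a)" if "1 \<le> n" for n
    using that
  proof (induction n rule: dec_induct)
    case base
    then show ?case
      using integral_point[of g] breakpoints_ends[OF y] by simp
  next
    case (step n)
    show ?case
    proof
      assume N: "Suc n \<le> N"
      have yn: "a \<le> y n" "y n \<le> y (Suc n)" "y (Suc n) \<le> b"
        using breakpoints_in[OF y, of n] breakpoints_in[OF y, of "Suc n"]
          breakpoints_le[OF y, of n "Suc n"] step N by auto
      have split: "{a..y (Suc n)} = {a..y n} \<union> {y n<..y (Suc n)}"
        using yn by auto
      have "(LINT z:{a..y (Suc n)}|M. g z) = (LINT z:{a..y n}|M. g z) + (LINT z:{y n<..y (Suc n)}|M. g z)"
        unfolding split using cont yn by (intro set_integral_Un integrable_on_continuous) auto
      moreover have "\<bar>(LINT z:{y n<..y (Suc n)}|M. g z) - g (y (Suc n)) * (u (y (Suc n)) - u (y n))\<bar>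
          \<le> mesh N y * (u (y (Suc n)) - u (y n))"
        using mesh_ge[of "Suc n" N y] step N yn by (intro integral_piece g) auto
      moreover have "\<bar>(LINT z:{a..y n}|M. g z) - (\<Sum>i=2..n. g (y i) * (u (y i) - u (y (i - 1))))\<bar>
          \<le> mesh N y * (u (y n) - u a)"
        using step N by auto
      moreover have "(\<Sum>i=2..Suc n. g (y i) * (u (y i) - u (y (i - 1)))) =
          (\<Sum>i=2..n. g (y i) * (u (y i) - u (y (i - 1)))) + g (y (Suc n)) * (u (y (Suc n)) - u (y n))"
        using step by simp
      ultimately show "\<bar>(LINT z:{a..y (Suc n)}|M. g z)
          - (\<Sum>i=2..Suc n. g (y i) * (u (y i) - u (y (i - 1))))\<bar> \<le> mesh N y * (u (y (Suc n)) - u a)"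
        by (simp add: abs_le_iff algebra_simps)
    qed
  qed
  from this[of N] show ?thesis
    using breakpoints_ends[OF y] u by (simp add: stieltjes_integral_def utilities_def)
qed

text \<open>The mass of \<open>{a<..z}\<close> is \<open>u z - u a\<close>, and
  \<open>u a = 0\<close>. The distance generated by the indicator class is therefore the uniform
  distance on \<open>{a..b}\<close>.\<close>

lemma integral_indicator:
  assumes "z \<in> {a..b}"
  shows "stieltjes_integral a b (indicator {a<..z}) u = u z"
proof -
  have eq: "(\<lambda>x. indicat_real {a..b} x * indicator {a<..z} x) = indicator {a<..z}"
    using assms by (auto simp: indicator_def)
  have "stieltjes_integral a b (indicator {a<..z}) u = measure M {a<..z}"
    unfolding stieltjes_integral_def set_lebesgue_integral_def real_scaleR_def eq by simp
  then show ?thesis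
    using measure_Ioc[of a z] assms u by (simp add: utilities_def)
qed

end

section \<open>Convex combinations of utilities\<close>

lemma utilities_affine:
  assumes "w \<in> utilities a b" "c \<in> utilities a b" "0 \<le> t" "t \<le> 1"
  shows "(\<lambda>x. (1 - t) * w x + t * c x) \<in> utilities a b"
  using assms by (auto simp: utilities_def mono_on_def intro!: continuous_intros add_mono mult_left_mono)

lemma pl_utilities_affine:
  assumes w: "w \<in> pl_utilities a b N y" and c: "c \<in> pl_utilities a b N y" and t: "0 \<le> t" "t \<le> 1"
  shows "(\<lambda>x. (1 - t) * w x + t * c x) \<in> pl_utilities a b N y"
proof -
  have "\<exists>p q. \<forall>x\<in>{y (i - 1)..y i}. (1 - t) * w x + t * c x = p + q * x" if i: "i \<in> {2..N}" for i
  proof -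
    obtain p q p' q' where "\<forall>x\<in>{y (i - 1)..y i}. w x = p + q * x"
      "\<forall>x\<in>{y (i - 1)..y i}. c x = p' + q' * x"
      using w c i unfolding pl_utilities_def by blast
    then show ?thesis
      by (intro exI[of _ "(1 - t) * p + t * p'"] exI[of _ "(1 - t) * q + t * q'"])
        (auto simp: algebra_simps)
  qed
  then show ?thesis
    using w c t by (auto simp: pl_utilities_def intro: utilities_affine)
qed

text \<open>Both classes reduce to expressions that are visibly affine in the integrator: a point
  value for an indicator, and a Riemann sum, up to an arbitrarily small error, for a Lipschitz
  integrand.\<close>

lemma stieltjes_integral_affine:
  assumes ab: "a < b" and w: "w \<in> utilities a b" and c: "c \<in> utilities a b" and t: "0 \<le> t" "t \<le> 1"
    and G: "g \<in> lipschitz_class a b \<or> g \<in> indicator_class a b"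
  shows "stieltjes_integral a b g (\<lambda>x. (1 - t) * w x + t * c x) =
    (1 - t) * stieltjes_integral a b g w + t * stieltjes_integral a b g c"
  using G
proof
  interpret w: stieltjes a b w using ab w by unfold_locales auto
  interpret c: stieltjes a b c using ab c by unfold_locales auto
  interpret wc: stieltjes a b "\<lambda>x. (1 - t) * w x + t * c x"
    using ab utilities_affine[OF w c t] by unfold_locales auto
  let ?I = "stieltjes_integral a b g"
  let ?m = "\<lambda>x. (1 - t) * w x + t * c x"
  {
    assume "g \<in> indicator_class a b"
    then show "?I ?m = (1 - t) * ?I w + t * ?I c"
      by (auto simp: indicator_class_def w.integral_indicator c.integral_indicator
          wc.integral_indicator)
  next
    assume g: "g \<in> lipschitz_class a b"
    \<comment> \<open>The budget \<open>e\<close> splits in two: \<open>e / 2\<close> for the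
      Riemann sum of the mixture, and the weighted errors
      \<open>(1 - t) * (e / 2) + t * (e / 2) = e / 2\<close> for those of \<open>w\<close> and
      \<open>c\<close>. The summand \<open>0\<close> gives the form that
      \<open>field_le_epsilon\<close> expects.\<close>
    have "\<bar>?I ?m - ((1 - t) * ?I w + t * ?I c)\<bar> \<le> 0 + e" if e: "e > 0" for e
    proof -
      obtain N y where y: "breakpoints a b N y" "mesh N y \<le> e / 2"
        using breakpoints_fine[OF ab, of "e / 2"] e by auto
      define S where "S u = (\<Sum>i=2..N. g (y i) * (u (y i) - u (y (i - 1))))" for u :: "real \<Rightarrow> real"
      have S: "S ?m = (1 - t) * S w + t * S c"
        by (simp add: S_def sum_distrib_left sum.distrib[symmetric] algebra_simps)
      have "\<bar>?I ?m - S ?m\<bar> \<le> e / 2"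
        using wc.integral_riemann_sum[OF g y(1)] y(2) by (simp add: S_def)
      moreover have b: "\<bar>?I w - S w\<bar> \<le> e / 2" "\<bar>?I c - S c\<bar> \<le> e / 2"
        using w.integral_riemann_sum[OF g y(1)] c.integral_riemann_sum[OF g y(1)] y(2)
        by (auto simp: S_def)
      have "\<bar>(1 - t) * (?I w - S w)\<bar> \<le> (1 - t) * (e / 2)" "\<bar>t * (?I c - S c)\<bar> \<le> t * (e / 2)"
        using mult_left_mono[OF b(1), of "1 - t"] mult_left_mono[OF b(2), of t] t
        by (simp_all add: abs_mult)
      moreover note S right_diff_distrib[of "1 - t" "?I w" "S w"] right_diff_distrib[of t "?I c" "S c"]
      moreover have "(1 - t) * (e / 2) + t * (e / 2) = e / 2"
        by (simp flip: distrib_right)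
      ultimately show ?thesis by linarith
    qed
    then have "\<bar>?I ?m - ((1 - t) * ?I w + t * ?I c)\<bar> \<le> 0"
      by (rule field_le_epsilon)
    then show "?I ?m = (1 - t) * ?I w + t * ?I c" by simp
  }
qed

section \<open>The pseudo-distance\<close>

lemma pseudo_dist_le_iff:
  "pseudo_dist a b G u v \<le> ereal e \<longleftrightarrow>
    (\<forall>g\<in>G. \<bar>stieltjes_integral a b g u - stieltjes_integral a b g v\<bar> \<le> e)"
  by (simp add: pseudo_dist_def SUP_le_iff)

lemma pseudo_dist_commute: "pseudo_dist a b G u v = pseudo_dist a b G v u"
  by (simp add: pseudo_dist_def abs_minus_commute)

text \<open>The bounds \<open>p\<close> and \<open>q\<close> are real, so the argument works
  integrand by integrand and adds no infinite distances.\<close>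

lemma pseudo_dist_triangle:
  assumes "pseudo_dist a b G u v \<le> ereal p" "pseudo_dist a b G v w \<le> ereal q"
  shows "pseudo_dist a b G u w \<le> ereal (p + q)"
  using assms unfolding pseudo_dist_le_iff by (fastforce simp: abs_le_iff)

text \<open>Over an empty class the supremum in \<open>ereal\<close> would be minus
  infinity.\<close>

lemma pseudo_dist_nonneg:
  assumes "G \<noteq> {}"
  shows "0 \<le> pseudo_dist a b G u v"
  using assms unfolding pseudo_dist_def by (auto intro: SUP_upper2)

lemma pseudo_dist_segment:
  assumes ab: "a < b" and w: "w \<in> utilities a b" and c: "c \<in> utilities a b"
    and G: "G \<subseteq> lipschitz_class a b \<union> indicator_class a b"
    and re: "0 \<le> r" "0 \<le> e" and d: "pseudo_dist a b G w c \<le> ereal (r + e)"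
  obtains t where "0 \<le> t" "t \<le> 1"
    "pseudo_dist a b G (\<lambda>x. (1 - t) * w x + t * c x) c \<le> ereal r"
    "pseudo_dist a b G w (\<lambda>x. (1 - t) * w x + t * c x) \<le> ereal e"
proof -
  \<comment> \<open>This fraction splits the length \<open>r + e\<close> into a part
    \<open>t * (r + e) = e\<close> covered from \<open>w\<close> and a part
    \<open>(1 - t) * (r + e) = r\<close> left to \<open>c\<close>. If \<open>r + e = 0\<close>,
    division by zero gives \<open>t = 0\<close>; both equations survive because then
    \<open>r = e = 0\<close>.\<close>
  define t where "t = e / (r + e)"
  have t: "0 \<le> t" "t \<le> 1"
    using re by (auto simp: t_def divide_le_eq_1)
  have te: "t * (r + e) = e"
    using re by (cases "r + e = 0") (auto simp: t_def)
  then have tr: "(1 - t) * (r + e) = r"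
    by (simp add: algebra_simps)
  let ?I = "\<lambda>u g. stieltjes_integral a b g u"
  let ?m = "\<lambda>x. (1 - t) * w x + t * c x"
  have I: "?I ?m g = (1 - t) * ?I w g + t * ?I c g" if "g \<in> G" for g
    using stieltjes_integral_affine[OF ab w c t, of g] that G by auto
  have d': "\<bar>?I w g - ?I c g\<bar> \<le> r + e" if "g \<in> G" for g
    using d that unfolding pseudo_dist_le_iff by auto
  have r: "\<bar>?I ?m g - ?I c g\<bar> \<le> r" if "g \<in> G" for g
  proof -
    have "?I ?m g - ?I c g = (1 - t) * (?I w g - ?I c g)"
      using I[OF that] by (simp add: algebra_simps)
    then show ?thesis
      using mult_left_mono[OF d'[OF that], of "1 - t"] t tr by (simp add: abs_mult)
  qed
  have e: "\<bar>?I w g - ?I ?m g\<bar> \<le> e" if "g \<in> G" for g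
  proof -
    have "?I w g - ?I ?m g = t * (?I w g - ?I c g)"
      using I[OF that] by (simp add: algebra_simps)
    then show ?thesis
      using mult_left_mono[OF d'[OF that], of t] t te by (simp add: abs_mult)
  qed
  have "pseudo_dist a b G ?m c \<le> ereal r" "pseudo_dist a b G w ?m \<le> ereal e"
    unfolding pseudo_dist_le_iff using r e by blast+
  then show ?thesis
    by (rule that[OF t])
qed

lemma excess_le:
  assumes "\<And>w. w \<in> U \<Longrightarrow> \<exists>w'\<in>V. d w w' \<le> C"
  shows "excess d U V \<le> C"
  unfolding excess_def
proof (rule SUP_least)
  fix w assume "w \<in> U"
  then obtain w' where "w' \<in> V" "d w w' \<le> C"
    using assms by blast
  then show "(INF w'\<in>V. d w w') \<le> C"
    by (rule INF_lower2)
qed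

section \<open>The projection\<close>

lemma pl_projection_breakpoint:
  assumes "breakpoints a b N y" "i \<in> {1..N}"
  shows "pl_projection y v (y i) = v (y i)"
\<comment> \<open>The first breakpoint is only a left end, of piece 2; every other one is the right
  end of its own piece.\<close>
proof (cases "i = 1")
  case True
  then show ?thesis
    using pl_projection_eq[OF assms(1), of 2 "y 1" v] breakpoints_less[OF assms(1), of 1 2]
      breakpoints_ends[OF assms(1)] by auto
next
  case False
  then have i: "i \<in> {2..N}" using assms(2) by auto
  have "y (i - 1) < y i"
    using breakpoints_less[OF assms(1), of "i - 1" i] i by auto
  then show ?thesis
    using pl_projection_eq[OF assms(1) i, of "y i" v] by auto
qed

text \<open>On a piece the interpolant adds to the left value a fraction in \<open>[0,1]\<close> of
  the non-negative increment of \<open>v\<close>.\<close>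

lemma pl_projection_between:
  assumes y: "breakpoints a b N y" and v: "v \<in> utilities a b"
    and i: "i \<in> {2..N}" and x: "x \<in> {y (i - 1)..y i}"
  shows "pl_projection y v x \<in> {v (y (i - 1))..v (y i)}"
proof -
  have lt: "y (i - 1) < y i"
    using breakpoints_less[OF y, of "i - 1" i] i by auto
  have "v (y (i - 1)) \<le> v (y i)"
    using breakpoints_in[OF y, of "i - 1"] breakpoints_in[OF y, of i] lt i
    by (intro utilities_mono[OF v]) auto
  moreover have "0 \<le> (x - y (i - 1)) / (y i - y (i - 1))" "(x - y (i - 1)) / (y i - y (i - 1)) \<le> 1"
    using x lt by auto
  ultimately have
    "0 \<le> (v (y i) - v (y (i - 1))) * ((x - y (i - 1)) / (y i - y (i - 1)))"
    "(v (y i) - v (y (i - 1))) * ((x - y (i - 1)) / (y i - y (i - 1))) \<le> v (y i) - v (y (i - 1))"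
    by (intro mult_nonneg_nonneg mult_left_le; simp)+
  then show ?thesis
    using pl_projection_eq[OF y i x, of v] by simp
qed

text \<open>The affine pieces have non-negative slopes because \<open>v\<close> is monotone. Gluing
  them one by one at common breakpoints preserves continuity and monotonicity.\<close>

lemma pl_projection_in:
  assumes y: "breakpoints a b N y" and v: "v \<in> utilities a b"
  shows "pl_projection y v \<in> pl_utilities a b N y"
proof -
  let ?p = "pl_projection y v"
  have affine: "\<exists>c d. 0 \<le> d \<and> (\<forall>x\<in>{y (i - 1)..y i}. ?p x = c + d * x)" if i: "i \<in> {2..N}" for i
  proof -
    define s where "s = (v (y i) - v (y (i - 1))) / (y i - y (i - 1))"
    have lt: "y (i - 1) < y i"
      using breakpoints_less[OF y, of "i - 1" i] i by auto
    have "v (y (i - 1)) \<le> v (y i)"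
      using breakpoints_in[OF y, of "i - 1"] breakpoints_in[OF y, of i] lt i
      by (intro utilities_mono[OF v]) auto
    then have "0 \<le> s" using lt by (simp add: s_def)
    moreover have "\<forall>x\<in>{y (i - 1)..y i}. ?p x = (v (y (i - 1)) - s * y (i - 1)) + s * x"
      using pl_projection_eq[OF y i, of _ v, folded s_def] by (simp add: algebra_simps)
    ultimately show ?thesis by blast
  qed
  have "n \<le> N \<longrightarrow> continuous_on {a..y n} ?p \<and> mono_on {a..y n} ?p" if "1 \<le> n" for n
    using that
  proof (induction n rule: dec_induct)
    case base
    then show ?case
      using breakpoints_ends[OF y] by (auto simp: mono_on_def)
  next
    case (step n)
    show ?case
    proof
      assume N: "Suc n \<le> N"
      have yn: "a \<le> y n" "y n \<le> y (Suc n)"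
        using breakpoints_in[OF y, of n] breakpoints_le[OF y, of n "Suc n"] step N by auto
      have IH: "continuous_on {a..y n} ?p" "mono_on {a..y n} ?p"
        using step N by auto
      obtain c d where d: "0 \<le> d" and p: "\<And>x. x \<in> {y n..y (Suc n)} \<Longrightarrow> ?p x = c + d * x"
        using affine[of "Suc n"] step N by auto
      have "continuous_on {y n..y (Suc n)} ?p \<longleftrightarrow> continuous_on {y n..y (Suc n)} (\<lambda>x. c + d * x)"
        using p by (intro continuous_on_cong) auto
      then have "continuous_on {y n..y (Suc n)} ?p"
        by (auto intro!: continuous_intros)
      then have "continuous_on ({a..y n} \<union> {y n..y (Suc n)}) ?p"
        using IH by (intro continuous_on_closed_Un) auto
      moreover have "{a..y n} \<union> {y n..y (Suc n)} = {a..y (Suc n)}"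
        using yn by auto
      moreover have "mono_on {a..y (Suc n)} ?p"
      proof (rule mono_onI)
        fix r s assume rs: "r \<in> {a..y (Suc n)}" "s \<in> {a..y (Suc n)}" "r \<le> s"
        have upper: "?p q \<le> ?p s" if "y n \<le> q" "q \<le> s" for q
          using p[of q] p[of s] that rs d by (auto intro: mult_left_mono)
        have lower: "?p r \<le> ?p q" if "r \<le> q" "q \<le> y n" for q
          using that rs by (intro mono_onD[OF IH(2)]) auto
        \<comment> \<open>When \<open>r\<close> and \<open>s\<close> lie on different sides of the
          seam, the comparison passes through the value at \<open>y n\<close>.\<close>
        consider "s \<le> y n" | "y n \<le> r" | "r \<le> y n" "y n \<le> s" by linarith
        then show "?p r \<le> ?p s"
          using upper[of r] upper[of "y n"] lower[of s] lower[of "y n"] rs(3)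
          by cases auto
      qed
      ultimately show "continuous_on {a..y (Suc n)} ?p \<and> mono_on {a..y (Suc n)} ?p"
        by simp
    qed
  qed
  from this[of N] have "?p \<in> utilities a b"
    using breakpoints_ends[OF y] pl_projection_breakpoint[OF y, of 1 v]
      pl_projection_breakpoint[OF y, of N v] v
    by (auto simp: utilities_def)
  then show ?thesis
    using affine unfolding pl_utilities_def by blast
qed

text \<open>This is the origin of \<open>max 2 L\<close>. For Lipschitz integrands \<open>v\<close>
  and its projection share one Riemann sum, each integral being within the mesh of it, which gives
  the factor 2. For indicators the distance is a difference of point values, bounded by the
  increment of \<open>v\<close> over one piece and hence by \<open>L\<close> times the mesh.\<close>

lemma pseudo_dist_pl_projection:
  assumes y: "breakpoints a b N y" and v: "v \<in> utilities a b" and L: "L-lipschitz_on {a..b} v"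
    and G: "G \<subseteq> lipschitz_class a b \<union> indicator_class a b"
  shows "pseudo_dist a b G v (pl_projection y v) \<le> ereal (max 2 L * mesh N y)"
  unfolding pseudo_dist_le_iff
proof
  let ?p = "pl_projection y v"
  let ?I = "stieltjes_integral a b"
  have p: "?p \<in> utilities a b"
    using pl_projection_in[OF y v] by (simp add: pl_utilities_def)
  interpret v: stieltjes a b v using breakpoints_ends[OF y] v by unfold_locales auto
  interpret p: stieltjes a b ?p using breakpoints_ends[OF y] p by unfold_locales auto
  have m: "k * mesh N y \<le> max 2 L * mesh N y" if "k \<le> max 2 L" for k
    using that mesh_nonneg[OF y] by (rule mult_right_mono)
  fix g assume "g \<in> G"
  then consider "g \<in> lipschitz_class a b" | "g \<in> indicator_class a b" using G by blast
  then show "\<bar>?I g v - ?I g ?p\<bar> \<le> max 2 L * mesh N y"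
  proof cases
    case 1
    have "?p (y i) = v (y i)" "?p (y (i - 1)) = v (y (i - 1))" if "i \<in> {2..N}" for i
      using that by (auto intro!: pl_projection_breakpoint[OF y])
    then have "(\<Sum>i=2..N. g (y i) * (?p (y i) - ?p (y (i - 1)))) =
        (\<Sum>i=2..N. g (y i) * (v (y i) - v (y (i - 1))))"
      by (intro sum.cong refl) (simp only:)
    then have "\<bar>?I g v - ?I g ?p\<bar> \<le> 2 * mesh N y"
      using v.integral_riemann_sum[OF 1 y] p.integral_riemann_sum[OF 1 y] by (simp add: abs_le_iff)
    then show ?thesis using m[of 2] by simp
  next
    case 2
    then obtain z where z: "z \<in> {a..b}" "g = indicator {a<..z}"
      by (auto simp: indicator_class_def)
    obtain i where i: "i \<in> {2..N}" "z \<in> {y (i - 1)..y i}"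
      using breakpoints_piece[OF y z(1)] by blast
    have yi: "y (i - 1) \<in> {a..b}" "y i \<in> {a..b}"
      using breakpoints_in[OF y, of "i - 1"] breakpoints_in[OF y, of i] i by auto
    have "v z \<in> {v (y (i - 1))..v (y i)}"
      using yi i z by (auto intro!: utilities_mono[OF v])
    \<comment> \<open>Both values lie between \<open>v (y (i - 1))\<close> and
      \<open>v (y i)\<close>.\<close>
    then have "\<bar>v z - ?p z\<bar> \<le> \<bar>v (y i) - v (y (i - 1))\<bar>"
      using pl_projection_between[OF y v i] by auto
    also have "\<dots> \<le> L * (y i - y (i - 1))"
      using lipschitz_onD[OF L yi(2,1)] i by (auto simp: dist_real_def)
    also have "\<dots> \<le> L * mesh N y"
      using mesh_ge[OF i(1), of y] lipschitz_on_nonneg[OF L] by (intro mult_left_mono) auto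
    also have "\<dots> \<le> max 2 L * mesh N y"
      by (rule m) simp
    finally show ?thesis
      using z by (simp add: v.integral_indicator p.integral_indicator)
  qed
qed

section \<open>Hausdorff distance of the balls\<close>

text \<open>A point of the piecewise linear ball is within \<open>r + \<delta>\<close> of
  \<open>v\<close>, so a move of length \<open>\<delta>\<close> towards \<open>v\<close> suffices. A
  point of the other ball is first projected, at cost \<open>?K\<close>; the projection is within
  \<open>r + \<delta> + ?K\<close> of \<open>u\<close>, and a move of length
  \<open>\<delta> + ?K\<close> towards \<open>u\<close> ends in the ball. The second direction gives
  the total \<open>\<delta> + 2 * ?K\<close>.\<close>

lemma hausdorff_balls_le:
  assumes y: "breakpoints a b N y" and u: "u \<in> pl_utilities a b N y" and v: "v \<in> utilities a b"
    and r: "0 \<le> r" and L: "\<forall>w\<in>utility_ball a b G v r. L-lipschitz_on {a..b} w"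
    and G: "G \<subseteq> lipschitz_class a b \<union> indicator_class a b"
    and d: "pseudo_dist a b G u v \<le> ereal \<delta>" and "0 \<le> \<delta>"
  shows "hausdorff (pseudo_dist a b G) (pl_utility_ball a b N y G u r) (utility_ball a b G v r)
    \<le> ereal (\<delta> + 2 * (max 2 L * mesh N y))"
proof -
  note ab = breakpoints_ends(4)[OF y]
  let ?d = "pseudo_dist a b G"
  let ?K = "max 2 L * mesh N y"
  have K: "0 \<le> ?K"
    using mesh_nonneg[OF y] by simp
  have u': "u \<in> utilities a b"
    using u by (simp add: pl_utilities_def)
  have "excess ?d (pl_utility_ball a b N y G u r) (utility_ball a b G v r) \<le> ereal (\<delta> + 2 * ?K)"
  proof (rule excess_le)
    fix w assume "w \<in> pl_utility_ball a b N y G u r"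
    then have w: "w \<in> utilities a b" "?d w u \<le> ereal r"
      by (auto simp: pl_utility_ball_def pl_utilities_def)
    obtain t where t: "0 \<le> t" "t \<le> 1" "?d (\<lambda>x. (1 - t) * w x + t * v x) v \<le> ereal r"
        "?d w (\<lambda>x. (1 - t) * w x + t * v x) \<le> ereal \<delta>"
      using pseudo_dist_segment[OF ab w(1) v G r \<open>0 \<le> \<delta>\<close> pseudo_dist_triangle[OF w(2) d]] by blast
    have "ereal \<delta> \<le> ereal (\<delta> + 2 * ?K)"
      using K by simp
    with t show "\<exists>w'\<in>utility_ball a b G v r. ?d w w' \<le> ereal (\<delta> + 2 * ?K)"
      using utilities_affine[OF w(1) v t(1,2)] unfolding utility_ball_def
      by (blast intro: order_trans)
  qed
  moreover have "excess ?d (utility_ball a b G v r) (pl_utility_ball a b N y G u r) \<le> ereal (\<delta> + 2 * ?K)"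
  proof (rule excess_le)
    fix w assume wB: "w \<in> utility_ball a b G v r"
    then have w: "w \<in> utilities a b" "?d w v \<le> ereal r"
      by (auto simp: utility_ball_def)
    let ?p = "pl_projection y w"
    have p: "?p \<in> pl_utilities a b N y"
      by (rule pl_projection_in[OF y w(1)])
    have wp: "?d w ?p \<le> ereal ?K"
      using pseudo_dist_pl_projection[OF y w(1) _ G] L wB by blast
    \<comment> \<open>The route runs from the projection to \<open>w\<close>, on to
      \<open>v\<close>, and then to \<open>u\<close>.\<close>
    have "?d ?p u \<le> ereal (?K + (r + \<delta>))"
      using wp w(2) d by (intro pseudo_dist_triangle) (simp_all add: pseudo_dist_commute)
    then have pu: "?d ?p u \<le> ereal (r + (\<delta> + ?K))"
      by (simp add: algebra_simps)
    obtain t where t: "0 \<le> t" "t \<le> 1" "?d (\<lambda>x. (1 - t) * ?p x + t * u x) u \<le> ereal r"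
        "?d ?p (\<lambda>x. (1 - t) * ?p x + t * u x) \<le> ereal (\<delta> + ?K)"
      using pseudo_dist_segment[OF ab _ u' G r _ pu] p K \<open>0 \<le> \<delta>\<close>
      by (auto simp: pl_utilities_def)
    have "?d w (\<lambda>x. (1 - t) * ?p x + t * u x) \<le> ereal (\<delta> + 2 * ?K)"
      using pseudo_dist_triangle[OF wp t(4)] by (simp add: algebra_simps)
    with t show "\<exists>w'\<in>pl_utility_ball a b N y G u r. ?d w w' \<le> ereal (\<delta> + 2 * ?K)"
      using pl_utilities_affine[OF p u t(1,2)] unfolding pl_utility_ball_def by blast
  qed
  ultimately show ?thesis
    by (simp add: hausdorff_def)
qed

theorem lemma3:
  fixes a b r L :: real and N :: nat and y :: "nat \<Rightarrow> real"
    and u v :: "real \<Rightarrow> real" and G :: "(real \<Rightarrow> real) set"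
  assumes "breakpoints a b N y"
    and "u \<in> pl_utilities a b N y"
    and "v \<in> utilities a b"
    and "r \<ge> 0"
    and "\<forall>w\<in>utility_ball a b G v r. L-lipschitz_on {a..b} w"
    and "G = lipschitz_class a b \<or> G = indicator_class a b"
  shows "hausdorff (pseudo_dist a b G) (pl_utility_ball a b N y G u r) (utility_ball a b G v r)
           \<le> pseudo_dist a b G u v + ereal (4 * max 2 L * mesh N y)
       \<and> hausdorff (pseudo_dist a b G)
             (pl_utility_ball a b N y G (pl_projection y v) r) (utility_ball a b G v r)
           \<le> ereal (6 * max 2 L * mesh N y)"
proof
  let ?K = "max 2 L * mesh N y"
  have G: "G \<subseteq> lipschitz_class a b \<union> indicator_class a b"
    using assms(6) by auto
  have K: "0 \<le> ?K"
    using mesh_nonneg[OF assms(1)] by simp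
  \<comment> \<open>The zero function and the indicator of the empty interval show that either
    choice of \<open>G\<close> is nonempty, so distances are non-negative.\<close>
  have "(\<lambda>x. 0) \<in> lipschitz_class a b" "indicator {a<..a} \<in> indicator_class a b"
    using breakpoints_ends(4)[OF assms(1)]
    by (auto simp: lipschitz_class_def indicator_class_def lipschitz_on_def intro!: exI[of _ a])
  then have "G \<noteq> {}"
    using assms(6) by auto
  then have d0: "0 \<le> pseudo_dist a b G u v"
    by (rule pseudo_dist_nonneg)
  show "hausdorff (pseudo_dist a b G) (pl_utility_ball a b N y G u r) (utility_ball a b G v r)
      \<le> pseudo_dist a b G u v + ereal (4 * max 2 L * mesh N y)"
  \<comment> \<open>An infinite distance makes the bound trivial, and minus infinity contradicts
    \<open>d0\<close>.\<close>
  proof (cases "pseudo_dist a b G u v")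
    case (real \<delta>)
    then have "hausdorff (pseudo_dist a b G) (pl_utility_ball a b N y G u r) (utility_ball a b G v r)
        \<le> ereal (\<delta> + 2 * ?K)"
      using d0 by (intro hausdorff_balls_le assms(1-5) G) auto
    also have "\<dots> \<le> pseudo_dist a b G u v + ereal (4 * max 2 L * mesh N y)"
      using real K by (simp add: algebra_simps)
    finally show ?thesis .
  qed (use d0 in auto)
  \<comment> \<open>As \<open>r \<ge> 0\<close>, \<open>v\<close> lies in its own ball and so
    inherits the Lipschitz bound \<open>L\<close>. Its projection is then within \<open>?K\<close>
    of it, and taking \<open>?K\<close> for the distance of the centres gives \<open>3 * ?K\<close>,
    below the claimed \<open>6 * ?K\<close>.\<close>
  have "v \<in> utility_ball a b G v r"
    using assms(3,4) by (simp add: utility_ball_def pseudo_dist_le_iff)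
  then have "pseudo_dist a b G (pl_projection y v) v \<le> ereal ?K"
    using pseudo_dist_pl_projection[OF assms(1,3) _ G, of L] assms(5)
    by (simp add: pseudo_dist_commute)
  then have "hausdorff (pseudo_dist a b G)
      (pl_utility_ball a b N y G (pl_projection y v) r) (utility_ball a b G v r) \<le> ereal (?K + 2 * ?K)"
    using K by (intro hausdorff_balls_le pl_projection_in assms(1,3-5) G) auto
  also have "\<dots> \<le> ereal (6 * max 2 L * mesh N y)"
    using K by (simp add: algebra_simps)
  finally show "hausdorff (pseudo_dist a b G)
      (pl_utility_ball a b N y G (pl_projection y v) r) (utility_ball a b G v r)
      \<le> ereal (6 * max 2 L * mesh N y)" .
qed

end
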